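(* Let $a,b,a_1,b_1$ be positive real numbers. Then $A(T_{ab})=A(T_{a_1b_1})$ if and only if $ab=a_1b_1$, where $ab$ and $a_1b_1$ are geometric products.
   Context: Work in the Euclidean plane (with Euclid's/Hilbert's axioms of plane geometry) with perpendicular $x$- and $y$-axes meeting at the origin $(0,0)$ and a common unit length on both axes. A line is regarded as parallel to itself. Geometric product: for real numbers $a$ and $b$, lay $a$ along the $y$-axis and $b$ along the $x$-axis; $ab$ ("$a$ multiplied by $b$") is defined to be the $x$-intercept of the line through the point $(0,a)$ that is parallel to the segment joining $(b,0)$ and $(0,1)$. No other notion of multiplication is presupposed. For positive real numbers $a$ and $b$, $T_{ab}$ denotes a right triangle whose legs have lengths $a$ and $b$ (the subscript records the pair of leg lengths), and $A(T_{ab})$ denotes its area, in the usual sense of Euclidean plane area. *)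

theory Defs
  imports "HOL-Analysis.Analysis"
begin

abbreviation point :: "real \<Rightarrow> real \<Rightarrow> real^2"
  where "point x y \<equiv> vector [x, y]"

definition is_line :: "(real^2) set \<Rightarrow> bool"
  where "is_line L \<longleftrightarrow> affine L \<and> aff_dim L = 1"

text \<open>Euclid's notion of parallel lines of the plane, with the convention that a line is
  parallel to itself.\<close>

definition parallel_lines :: "(real^2) set \<Rightarrow> (real^2) set \<Rightarrow> bool"
  where "parallel_lines L M \<longleftrightarrow> is_line L \<and> is_line M \<and> (L = M \<or> L \<inter> M = {})"

text \<open>The affine hull below is the line carrying the segment from \<open>(b, 0)\<close> to \<open>(0, 1)\<close>;
  it is never parallel to the \<open>x\<close>-axis, so the intercept exists and is unique for all real
  \<open>a\<close> and \<open>b\<close>.\<close>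

definition geom_prod :: "real \<Rightarrow> real \<Rightarrow> real"
  where "geom_prod a b =
    (THE x. \<exists>L. parallel_lines L (affine hull {point b 0, point 0 1})
                 \<and> point 0 a \<in> L \<and> point x 0 \<in> L)"

text \<open>The triangle is the filled region with right angle at \<open>C\<close>; it is nondegenerate exactly when
  \<open>a\<close> and \<open>b\<close> are positive.\<close>

definition right_triangle :: "real \<Rightarrow> real \<Rightarrow> (real^2) set \<Rightarrow> bool"
  where "right_triangle a b T \<longleftrightarrow>
    (\<exists>A B C. orthogonal (A - C) (B - C) \<and> dist C A = a \<and> dist C B = b
           \<and> T = convex hull {A, B, C})"

definition area :: "(real^2) set \<Rightarrow> real"
  where "area S = measure lebesgue S"

end

theory Submission
  imports Defs
begin

text \<open>Both sides of the equivalence are the ordinary product of the leg lengths in disguise.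

  On the side of the geometric product, the line through \<open>(b, 0)\<close> and \<open>(0, 1)\<close> is the level set
  at height \<open>b\<close> of the linear functional \<open>\<phi>(p) = p$1 + b p$2\<close>, and its parallels are the level
  sets of \<open>\<phi>\<close>.  Because \<open>\<phi>(0, a) = a b\<close> and \<open>\<phi>(x, 0) = x\<close>, the parallel through \<open>(0, a)\<close>
  meets the \<open>x\<close>-axis at \<open>x = a b\<close>.  This is \<open>geom_prod_eq_mult\<close>.

  On the side of the area, a triangle has half the area of the parallelogram spanned by two edges
  \<open>u\<close>, \<open>v\<close> at a vertex, and Lagrange's identity \<open>det(u, v)\<^sup>2 + (u \<bullet> v)\<^sup>2 = \<bar>u\<bar>\<^sup>2 \<bar>v\<bar>\<^sup>2\<close>
  reduces that area to \<open>\<bar>u\<bar> \<bar>v\<bar>\<close> when the edges are orthogonal.  So the area is \<open>a b / 2\<close>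
  wherever the triangle lies; this is \<open>area_right_triangle\<close>.\<close>

text \<open>The level set of \<open>\<phi>\<close> at height \<open>a b\<close>, presented by two of its points.  They differ by
  \<open>(b, -1)\<close>, hence stay distinct even for \<open>b = 0\<close>; the points \<open>(a b, 0)\<close> and \<open>(0, a)\<close> would
  coincide for \<open>a = 0\<close>.  For \<open>a = 1\<close> the set is the line from which \<open>geom_prod\<close> takes its
  direction.\<close>

lemma affine_hull_slant:
  "affine hull {point b (a - 1), point 0 a} = {p. p $ 1 + b * p $ 2 = a * b}"
proof (intro equalityI subsetI)
  fix p assume "p \<in> affine hull {point b (a - 1), point 0 a}"
  then obtain u v where uv: "u + v = 1" and p: "p = u *\<^sub>R point b (a - 1) + v *\<^sub>R point 0 a"
    by (auto simp: affine_hull_2)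
  have "p $ 1 + b * p $ 2 = a * b * (u + v)"
    by (simp add: p algebra_simps)
  then show "p \<in> {p. p $ 1 + b * p $ 2 = a * b}"
    by (simp add: uv)
next
  fix p :: "real^2" assume "p \<in> {p. p $ 1 + b * p $ 2 = a * b}"
  then have "p = (a - p $ 2) *\<^sub>R point b (a - 1) + (1 - a + p $ 2) *\<^sub>R point 0 a"
    by (auto simp: vec_eq_iff forall_2 algebra_simps)
  moreover have "(a - p $ 2) + (1 - a + p $ 2) = 1"
    by simp
  ultimately show "p \<in> affine hull {point b (a - 1), point 0 a}"
    unfolding affine_hull_2 by blast
qed

lemma is_line_affine_hull_2: "p \<noteq> q \<Longrightarrow> is_line (affine hull {p, q})"
  by (simp add: is_line_def)

lemma is_line_slant: "is_line {p. p $ 1 + b * p $ 2 = a * b}"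
proof -
  have "point b (a - 1) \<noteq> point 0 a"
    by (simp add: vec_eq_iff forall_2)
  then show ?thesis
    using is_line_affine_hull_2 affine_hull_slant by metis
qed

text \<open>Parallelism speaks only of equality or disjointness, with no direction to compare, so
  uniqueness of the intercept comes from affine interpolation: if \<open>\<phi>\<close> took different values at
  \<open>(0, a)\<close> and \<open>(x, 0)\<close>, it would take every real value on \<open>L\<close>, and \<open>L\<close> would meet the level
  set at height \<open>b\<close>.\<close>

lemma parallel_slant_intercept:
  assumes par: "parallel_lines L {p. p $ 1 + b * p $ 2 = b}"
    and a: "point 0 a \<in> L" and x: "point x 0 \<in> L"
  shows "x = a * b"
proof (cases "L = {p. p $ 1 + b * p $ 2 = b}")
  case True
  then show ?thesis
    using a x by (simp add: mult.commute)
next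
  case False
  then have disjoint: "L \<inter> {p. p $ 1 + b * p $ 2 = b} = {}" and "affine L"
    using par by (auto simp: parallel_lines_def is_line_def)
  show ?thesis
  proof (rule ccontr)
    assume "x \<noteq> a * b"
    \<comment> \<open>These weights solve \<open>u (a b) + v x = b\<close> together with \<open>u + v = 1\<close>.\<close>
    define u where "u = (x - b) / (x - a * b)"
    define v where "v = (b - a * b) / (x - a * b)"
    have uv: "u + v = 1" and weights: "u * (a * b) + v * x = b"
      using \<open>x \<noteq> a * b\<close> by (simp_all add: u_def v_def divide_simps) (simp_all add: algebra_simps)
    have "u *\<^sub>R point 0 a + v *\<^sub>R point x 0 \<in> L"
      using \<open>affine L\<close> a x uv by (rule mem_affine)
    moreover have "u *\<^sub>R point 0 a + v *\<^sub>R point x 0 \<in> {p. p $ 1 + b * p $ 2 = b}"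
      using weights by (simp add: algebra_simps)
    ultimately show False
      using disjoint by blast
  qed
qed

lemma geom_prod_eq_mult: "geom_prod a b = a * b"
proof -
  define M where "M = {p :: real^2. p $ 1 + b * p $ 2 = b}"
  define L where "L = {p :: real^2. p $ 1 + b * p $ 2 = a * b}"
  have M: "affine hull {point b 0, point 0 1} = M"
    using affine_hull_slant[of b 1] by (simp add: M_def)
  have "is_line M"
    using is_line_slant[of b 1] by (simp add: M_def)
  moreover have "is_line L"
    unfolding L_def by (rule is_line_slant)
  moreover have "L = M \<or> L \<inter> M = {}"
    by (auto simp: L_def M_def)
  ultimately have "parallel_lines L M"
    by (simp add: parallel_lines_def)
  moreover have "point 0 a \<in> L" "point (a * b) 0 \<in> L"
    by (simp_all add: L_def)
  ultimately show ?thesis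
    unfolding geom_prod_def M
    by (intro the_equality) (auto simp: M_def intro: parallel_slant_intercept)
qed

lemma lagrange_identity_2:
  fixes u v :: "real^2"
  shows "(u $ 1 * v $ 2 - v $ 1 * u $ 2)\<^sup>2 + (u \<bullet> v)\<^sup>2 = (norm u)\<^sup>2 * (norm v)\<^sup>2"
  by (simp only: power2_norm_eq_inner)
     (simp add: inner_vec_def sum_2 power2_eq_square algebra_simps)

lemma orthogonal_imp_abs_det:
  fixes u v :: "real^2"
  assumes "orthogonal u v"
  shows "\<bar>u $ 1 * v $ 2 - v $ 1 * u $ 2\<bar> = norm u * norm v"
proof -
  have "(u $ 1 * v $ 2 - v $ 1 * u $ 2)\<^sup>2 = (norm u * norm v)\<^sup>2"
    using lagrange_identity_2[of u v] assms by (simp add: orthogonal_def power_mult_distrib)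
  then show ?thesis
    by (metis abs_of_nonneg mult_nonneg_nonneg norm_ge_zero power2_eq_iff_nonneg power2_abs abs_ge_zero)
qed

lemma area_right_triangle:
  assumes "right_triangle a b T"
  shows "area T = a * b / 2"
proof -
  obtain A B C where orth: "orthogonal (A - C) (B - C)"
    and legs: "dist C A = a" "dist C B = b" and "T = convex hull {A, B, C}"
    using assms by (auto simp: right_triangle_def)
  \<comment> \<open>Listing \<open>C\<close> first makes the area formula use the edges that meet in the right angle.\<close>
  then have T: "T = convex hull {C, B, A}"
    by (simp add: insert_commute)
  have "compact T"
    unfolding T by (intro finite_imp_compact_convex_hull) auto
  then have "area T = measure lborel T"
    unfolding area_def by (intro measure_completion) (auto dest: compact_imp_closed)
  also have "\<dots> = norm (A - C) * norm (B - C) / 2"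
    using orthogonal_imp_abs_det[OF orth] by (simp add: T content_triangle)
  also have "\<dots> = a * b / 2"
    using legs by (simp add: dist_norm norm_minus_commute)
  finally show ?thesis .
qed

theorem theorem6:
  fixes a b a\<^sub>1 b\<^sub>1 :: real and T T\<^sub>1 :: "(real^2) set"
  assumes "0 < a" "0 < b" "0 < a\<^sub>1" "0 < b\<^sub>1"
    and "right_triangle a b T" and "right_triangle a\<^sub>1 b\<^sub>1 T\<^sub>1"
  shows "area T = area T\<^sub>1 \<longleftrightarrow> geom_prod a b = geom_prod a\<^sub>1 b\<^sub>1"
  using assms(5,6) by (simp add: area_right_triangle geom_prod_eq_mult)

end
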